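(* Let $r\ge1$ and let $u\neq v$ be vertices of the Kostka polytope $P_r$ labeled $(a,b,\ell)$ and $(a',b',\ell')$ respectively, where $a-b\le a'-b'$. Then $\{u,v\}$ is the vertex set of a face of $P_r$ (i.e. $\mathrm{conv}\{u,v\}$ is an edge) if and only if one of the following holds: (1) $a=b$ and at least one of: (i) $a'=b'$; (ii) $a=b'$; (iii) $a\ge a'$; (iv) $\ell'\ge a$; (2) $a\neq b$ and at least one of: (i) at least two of the three equalities $a=a'$, $b=b'$, $\ell=\ell'$ hold; (ii) $\ell\ge a'$; (iii) $\ell'\ge a$.
   Context: For a positive integer $r$, a partition with at most $r$ parts is written as a non-increasing $r$-tuple of nonnegative integers; $\mathrm{Par}_r(n)$ is the set of those with entries summing to $n$. For $\lambda,\mu\in\mathrm{Par}_r(n)$, $\lambda$ dominates $\mu$ if $\sum_{i=1}^k\lambda_i\ge\sum_{i=1}^k\mu_i$ for all $k\le r$. The $r$-Kostka cone $\mathcal{K}_r\subseteq\mathbb{R}^{2r}$ is the convex hull of all points $(\lambda_1,\dots,\lambda_r,\mu_1,\dots,\mu_r)$ with $\lambda,\mu\in\mathrm{Par}_r(n)$ for some $n$ and $\lambda$ dominating $\mu$. The Kostka polytope $P_r$ is $\mathcal{K}_r\cap\{x:\sum_{i=1}^r(\lambda_i+\mu_i)=1\}$, whose vertices are the intersections with the extremal rays of $\mathcal{K}_r$. It is known that the extremal rays of $\mathcal{K}_r$ are exactly the rays spanned by the vectors $\big((a-\ell)^b,0^{r-b};\,(a-\ell)^\ell,(b-\ell)^{a-\ell},0^{r-a}\big)$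 for integers $0\le\ell<b\le a\le r$, where exponents denote repetition of an entry. A vertex of $P_r$ on the ray of such a vector with $a\neq b$ (so $0\le\ell<b<a\le r$) is labeled $(a,b,\ell)$; when $a=b$ the ray does not depend on $\ell$, and the vertex is labeled $(a,a,a)$. *)

theory Defs
  imports "HOL-Analysis.Analysis"
begin

text \<open>
  The index set \<open>{1, \<dots>, r}\<close> is a finite linearly ordered type \<open>'n\<close> with \<open>r = CARD('n)\<close>, and
  \<open>\<real>\<^sup>2\<^sup>r\<close> is \<open>(real ^ 'n) \<times> (real ^ 'n)\<close>, the components holding \<open>\<lambda>\<close> and \<open>\<mu>\<close>.
\<close>

text \<open>The 1-based position of an index: the \<open>i\<close> with \<open>position i = k\<close> stands for the index \<open>k\<close>.\<close>

definition position :: "'n::{finite,linorder} \<Rightarrow> nat" where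
  "position i = card {j. j \<le> i}"

definition Par :: "nat \<Rightarrow> (nat ^ 'n::{finite,linorder}) set" where
  "Par n = {p. (\<forall>i j. i \<le> j \<longrightarrow> p $ j \<le> p $ i) \<and> (\<Sum>i\<in>UNIV. p $ i) = n}"

definition dominates :: "nat ^ 'n::{finite,linorder} \<Rightarrow> nat ^ 'n::{finite,linorder} \<Rightarrow> bool" where
  "dominates p q \<longleftrightarrow> (\<forall>k. (\<Sum>i | i \<le> k. q $ i) \<le> (\<Sum>i | i \<le> k. p $ i))"

definition kostka_point ::
    "nat ^ 'n::{finite,linorder} \<Rightarrow> nat ^ 'n::{finite,linorder} \<Rightarrow>
      (real ^ 'n::{finite,linorder}) \<times> (real ^ 'n::{finite,linorder})" where
  "kostka_point p q = ((\<chi> i. real (p $ i)), (\<chi> i. real (q $ i)))"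

definition kostka_cone :: "((real ^ 'n::{finite,linorder}) \<times> (real ^ 'n::{finite,linorder})) set" where
  "kostka_cone =
     convex hull {kostka_point p q | p q n. p \<in> Par n \<and> q \<in> Par n \<and> dominates p q}"

definition kostka_polytope :: "((real ^ 'n::{finite,linorder}) \<times> (real ^ 'n::{finite,linorder})) set" where
  "kostka_polytope = kostka_cone \<inter> {(x, y). (\<Sum>i\<in>UNIV. x $ i + y $ i) = 1}"

definition ray_vector ::
    "nat \<Rightarrow> nat \<Rightarrow> nat \<Rightarrow> (real ^ 'n::{finite,linorder}) \<times> (real ^ 'n::{finite,linorder})" where
  "ray_vector a b l =
     ((\<chi> i. if position i \<le> b then real a - real l else 0),
      (\<chi> i. if position i \<le> l then real a - real l
            else if position i \<le> a then real b - real l else 0))"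

text \<open>
  For \<open>a = b\<close> all vectors \<open>ray_vector a a m\<close> with \<open>m < a\<close> span the same ray, whose label is
  \<open>(a, a, a)\<close>.
\<close>

definition labeled ::
    "(real ^ 'n::{finite,linorder}) \<times> (real ^ 'n::{finite,linorder})
      \<Rightarrow> nat \<times> nat \<times> nat \<Rightarrow> bool" where
  "labeled v = (\<lambda>(a, b, l).
     (l < b \<and> b < a \<and> a \<le> CARD('n) \<and> v \<in> cone hull {ray_vector a b l}) \<or>
     (b = a \<and> l = a \<and> a \<le> CARD('n) \<and> (\<exists>m<a. v \<in> cone hull {ray_vector a a m})))"

end

theory Submission
  imports Defs
begin

text \<open>
  For a point \<open>(\<lambda>, \<mu>)\<close> let \<open>p\<^sub>k = \<lambda>\<^sub>k - \<lambda>\<^sub>k\<^sub>+\<^sub>1\<close>, \<open>q\<^sub>k = \<mu>\<^sub>k - \<mu>\<^sub>k\<^sub>+\<^sub>1\<close>, and let \<open>D\<^sub>k\<close> be the difference of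
  the \<open>k\<close>-th prefix sums. The Kostka cone is cut out by \<open>p, q, D \<ge> 0\<close> and \<open>D\<^sub>r = 0\<close>, so the smallest face
  through a point is determined by its support, the set of these inequalities that are strict, and
  two vertices span an edge iff the union of their supports contains the support of no third vertex.

  The vertex labeled \<open>(a, b, l)\<close> is supported on \<open>p\<^sub>b\<close>, \<open>q\<^sub>a\<close>, \<open>q\<^sub>l\<close> and the \<open>D\<^sub>k\<close> with \<open>l < k < a\<close>. The support
  of every nonzero point of the cone contains one of these: choose \<open>b\<close> with \<open>p\<^sub>b > 0\<close> and note that the
  second difference of \<open>D\<close> is \<open>q - p\<close>. If \<open>D\<^sub>b = 0\<close>, this forces \<open>q\<^sub>b > 0\<close>. Otherwise, let \<open>l < b < a\<close> be the
  zeros of \<open>D\<close> nearest to \<open>b\<close>; there the second difference is positive, so \<open>q\<^sub>a > 0\<close>, and \<open>q\<^sub>l > 0\<close>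
  unless \<open>l = 0\<close>. Hence the labeled points are all the vertices, and the edge condition becomes a
  question about integer intervals.
\<close>

section \<open>Faces of feasible regions of linear inequalities\<close>

locale linear_constraints =
  fixes A :: "'a::euclidean_space set" and f :: "'j \<Rightarrow> 'a \<Rightarrow> real" and J :: "'j set"
  assumes affine_A: "affine A" and finite_J: "finite J" and linear_f: "\<And>j. j \<in> J \<Longrightarrow> linear (f j)"
begin

definition feasible :: "'a set" where
  "feasible = {x \<in> A. \<forall>j\<in>J. 0 \<le> f j x}"

definition support :: "'a \<Rightarrow> 'j set" where
  "support x = {j \<in> J. f j x \<noteq> 0}"

definition minimal_face :: "'a \<Rightarrow> 'a set" where
  "minimal_face x = {y \<in> feasible. support y \<subseteq> support x}"

lemma constraint_combination:
  "j \<in> J \<Longrightarrow> f j (s *\<^sub>R x + t *\<^sub>R y) = s * f j x + t * f j y"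
  by (simp add: linear_f linear_add linear_scale)

lemma convex_feasible: "convex feasible"
proof (rule convexI)
  fix x y :: 'a and s t :: real
  assume xy: "x \<in> feasible" "y \<in> feasible" and st: "0 \<le> s" "0 \<le> t" "s + t = 1"
  then have "s *\<^sub>R x + t *\<^sub>R y \<in> A"
    using affine_A by (simp add: feasible_def affine_def)
  with xy st show "s *\<^sub>R x + t *\<^sub>R y \<in> feasible"
    by (simp add: feasible_def constraint_combination)
qed

lemma closed_feasible: "closed feasible"
proof -
  have "closed {x. 0 \<le> f j x}" if "j \<in> J" for j
    using linear_f[OF that]
    by (intro closed_Collect_le continuous_intros linear_continuous_on) (simp add: linear_conv_bounded_linear)
  then have "closed (A \<inter> (\<Inter>j\<in>J. {x. 0 \<le> f j x}))"
    using affine_A by (auto intro: affine_closed)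
  moreover have "feasible = A \<inter> (\<Inter>j\<in>J. {x. 0 \<le> f j x})"
    by (auto simp: feasible_def)
  ultimately show ?thesis by simp
qed

lemma support_scaleR: "c \<noteq> 0 \<Longrightarrow> support (c *\<^sub>R x) = support x"
  by (auto simp: support_def linear_f linear_scale)

lemma support_convex_combination:
  assumes "x \<in> feasible" "y \<in> feasible" "0 < s" "0 < t"
  shows "support (s *\<^sub>R x + t *\<^sub>R y) = support x \<union> support y"
  using assms
  by (auto simp: support_def feasible_def constraint_combination add_nonneg_eq_0_iff)

lemma minimal_face_face_of: "minimal_face x face_of feasible"
  unfolding face_of_def
proof (intro conjI ballI impI)
  show "minimal_face x \<subseteq> feasible" by (auto simp: minimal_face_def)
  show "convex (minimal_face x)"
    using convex_feasible unfolding minimal_face_def convex_def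
    by (auto simp: support_def constraint_combination subset_iff)
next
  fix y z w
  assume yz: "y \<in> feasible" "z \<in> feasible" and w: "w \<in> minimal_face x" "w \<in> open_segment y z"
  then obtain t where "0 < t" "t < 1" "w = (1 - t) *\<^sub>R y + t *\<^sub>R z"
    by (auto simp: in_segment)
  with yz have "support w = support y \<union> support z"
    by (simp add: support_convex_combination)
  with w yz show "y \<in> minimal_face x" "z \<in> minimal_face x"
    by (auto simp: minimal_face_def)
qed

lemma extreme_point_of_minimal_face_iff:
  "x extreme_point_of minimal_face m \<longleftrightarrow> x extreme_point_of feasible \<and> support x \<subseteq> support m"
  unfolding extreme_point_of_face[OF minimal_face_face_of]
  by (auto simp: minimal_face_def extreme_point_of_def)

lemma ex_extension_beyond:
  assumes x: "x \<in> feasible" and y: "y \<in> minimal_face x"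
  obtains d where "0 < d" "x + d *\<^sub>R (x - y) \<in> feasible"
proof -
  have yf: "y \<in> feasible" and supp: "support y \<subseteq> support x"
    using y by (auto simp: minimal_face_def)
  have f_eq: "f j (x + d *\<^sub>R (x - y)) = f j x + d * (f j x - f j y)" if "j \<in> J" for j d
    using linear_f[OF that] by (simp add: linear_add linear_diff linear_scale)
  have "\<forall>\<^sub>F d in at_right 0. 0 \<le> f j (x + d *\<^sub>R (x - y))" if j: "j \<in> J" for j
  proof (cases "f j x = 0")
    case True
    with j supp have "f j y = 0" by (auto simp: support_def)
    with True j show ?thesis by (simp add: f_eq)
  next
    case False
    with x j have "0 < f j x" by (auto simp: feasible_def less_le)
    moreover have "((\<lambda>d. f j x + d * (f j x - f j y)) \<longlongrightarrow> f j x + 0 * (f j x - f j y)) (at_right 0)"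
      by (intro tendsto_intros)
    ultimately have "\<forall>\<^sub>F d in at_right 0. 0 < f j x + d * (f j x - f j y)"
      by (auto dest: order_tendstoD(1))
    then show ?thesis
      by eventually_elim (simp add: f_eq[OF j])
  qed
  then have "\<forall>\<^sub>F d in at_right 0. 0 < d \<and> (\<forall>j\<in>J. 0 \<le> f j (x + d *\<^sub>R (x - y)))"
    by (intro eventually_conj eventually_at_right_less eventually_ball_finite finite_J ballI)
  then obtain d :: real where d: "0 < d" "\<forall>j\<in>J. 0 \<le> f j (x + d *\<^sub>R (x - y))"
    using eventually_happens' trivial_limit_at_right_real by blast
  have "x + d *\<^sub>R (x - y) \<in> A"
    using x yf by (intro mem_affine_3_minus[OF affine_A]) (auto simp: feasible_def)
  then have "x + d *\<^sub>R (x - y) \<in> feasible"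
    using d by (simp add: feasible_def)
  with d that show thesis by blast
qed

lemma minimal_face_subset_face:
  assumes F: "F face_of feasible" and x: "x \<in> F"
  shows "minimal_face x \<subseteq> F"
proof
  fix y assume y: "y \<in> minimal_face x"
  have "x \<in> feasible" using F x face_of_imp_subset by blast
  with y obtain d where d: "0 < d" "x + d *\<^sub>R (x - y) \<in> feasible"
    by (blast elim: ex_extension_beyond)
  show "y \<in> F"
  proof (cases "y = x")
    case False
    define t where "t = 1 / (1 + d)"
    have t: "0 < t" "t < 1" "t * (1 + d) = 1" using d by (simp_all add: t_def)
    have "(1 - t) *\<^sub>R y + t *\<^sub>R (x + d *\<^sub>R (x - y)) = y + (t * (1 + d)) *\<^sub>R (x - y)"
      by (simp add: algebra_simps)
    then have "x = (1 - t) *\<^sub>R y + t *\<^sub>R (x + d *\<^sub>R (x - y))"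
      by (simp add: t)
    moreover from this have "y \<noteq> x + d *\<^sub>R (x - y)"
      using False by (metis scaleR_collapse)
    ultimately have "x \<in> open_segment y (x + d *\<^sub>R (x - y))"
      using t(1,2) by (auto simp: in_segment)
    moreover have "y \<in> feasible" using y by (simp add: minimal_face_def)
    ultimately show ?thesis using F x d(2) unfolding face_of_def by blast
  qed (use x in simp)
qed

lemma minimal_face_extreme_point:
  assumes "x extreme_point_of feasible"
  shows "minimal_face x = {x}"
proof
  show "minimal_face x \<subseteq> {x}"
    using assms by (intro minimal_face_subset_face) (simp_all add: face_of_singleton)
  show "{x} \<subseteq> minimal_face x"
    using assms by (simp add: minimal_face_def extreme_point_of_def)
qed

theorem extreme_points_of_compact_feasible:
  assumes compact: "compact feasible" and V: "V \<subseteq> feasible"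
    and covering: "\<And>x. x \<in> feasible \<Longrightarrow> \<exists>v\<in>V. support v \<subseteq> support x"
    and minimal: "\<And>v w. v \<in> V \<Longrightarrow> w \<in> V \<Longrightarrow> support v \<subseteq> support w \<Longrightarrow> v = w"
  shows "{x. x extreme_point_of feasible} = V"
proof
  show extreme: "{x. x extreme_point_of feasible} \<subseteq> V"
  proof
    fix x assume "x \<in> {x. x extreme_point_of feasible}"
    then have x: "x \<in> feasible" "minimal_face x = {x}"
      by (simp_all add: minimal_face_extreme_point) (simp add: extreme_point_of_def)
    then obtain v where "v \<in> V" "support v \<subseteq> support x" using covering by blast
    with V x show "x \<in> V" by (auto simp: minimal_face_def)
  qed
  show "V \<subseteq> {x. x extreme_point_of feasible}"
  proof
    fix v assume v: "v \<in> V"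
    have face: "minimal_face v face_of feasible" by (rule minimal_face_face_of)
    have "v \<in> minimal_face v" using v V by (auto simp: minimal_face_def)
    then obtain x where "x extreme_point_of minimal_face v"
      using face_of_imp_compact[OF convex_feasible compact face] face_of_imp_convex[OF face]
        extreme_point_exists_convex convex_feasible by (metis empty_iff)
    then have x: "x extreme_point_of feasible" "support x \<subseteq> support v"
      by (auto simp: extreme_point_of_minimal_face_iff)
    with extreme minimal v have "x = v" by blast
    with x show "v \<in> {x. x extreme_point_of feasible}" by simp
  qed
qed

theorem ex_face_extreme_points_iff:
  assumes u: "u extreme_point_of feasible" and v: "v extreme_point_of feasible"
  shows "(\<exists>F. F face_of feasible \<and> {x. x extreme_point_of F} = {u, v}) \<longleftrightarrow>
    (\<forall>w. w extreme_point_of feasible \<and> support w \<subseteq> support u \<union> support v \<longrightarrow> w \<in> {u, v})"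
    (is "?face \<longleftrightarrow> ?no_other")
proof -
  define m where "m = (1/2) *\<^sub>R u + (1/2) *\<^sub>R v"
  have support_m: "support m = support u \<union> support v"
    using u v by (simp add: m_def support_convex_combination extreme_point_of_def)
  show ?thesis
  proof
    assume ?face
    then obtain F where F: "F face_of feasible" and ext: "{x. x extreme_point_of F} = {u, v}" by blast
    then have "u \<in> F" "v \<in> F" by (auto simp: extreme_point_of_def)
    then have "m \<in> F"
      unfolding m_def by (intro convexD[OF face_of_imp_convex[OF F]] convex_feasible) auto
    then have "minimal_face m \<subseteq> F" by (rule minimal_face_subset_face[OF F])
    moreover have "w \<in> minimal_face m"
      if "w extreme_point_of feasible" "support w \<subseteq> support u \<union> support v" for w
      using that by (simp add: minimal_face_def support_m extreme_point_of_def)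
    ultimately have "w extreme_point_of F"
      if "w extreme_point_of feasible" "support w \<subseteq> support u \<union> support v" for w
      unfolding extreme_point_of_face[OF F] using that by blast
    with ext show ?no_other by blast
  next
    assume ?no_other
    with u v have "{x. x extreme_point_of minimal_face m} = {u, v}"
      by (auto simp: extreme_point_of_minimal_face_iff support_m)
    then show ?face using minimal_face_face_of by blast
  qed
qed

end

section \<open>The Kostka cone in terms of inequalities\<close>

type_synonym 'n point = "(real, 'n) vec \<times> (real, 'n) vec"

lemma position_strict_mono: "i < j \<Longrightarrow> position i < position (j :: 'n::{finite,linorder})"
  unfolding position_def by (rule psubset_card_mono) (auto, metis leD mem_Collect_eq order_refl)

lemma position_le_iff: "position i \<le> position j \<longleftrightarrow> i \<le> (j :: 'n::{finite,linorder})"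
  by (metis leD leI order.order_iff_strict position_strict_mono)

lemma position_eq_iff: "position i = position j \<longleftrightarrow> i = (j :: 'n::{finite,linorder})"
  by (metis order_antisym order_refl position_le_iff)

lemma range_position: "range (position :: 'n::{finite,linorder} \<Rightarrow> nat) = {1..CARD('n)}"
proof (rule card_subset_eq)
  show "range (position :: 'n \<Rightarrow> nat) \<subseteq> {1..CARD('n)}"
    by (auto simp: position_def card_gt_0_iff Suc_le_eq intro!: card_mono)
  show "card (range (position :: 'n \<Rightarrow> nat)) = card {1..CARD('n)}"
    by (simp add: card_image inj_on_def position_eq_iff)
qed simp

lemma position_in: "position (i :: 'n::{finite,linorder}) \<in> {1..CARD('n)}"
  using range_position by blast

lemma ex_position:
  assumes "k \<in> {1..CARD('n)}"
  obtains i :: "'n::{finite,linorder}" where "position i = k"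
  using assms range_position[where 'n='n] by (metis imageE)

lemma card_position_le: "card {i :: 'n::{finite,linorder}. position i \<le> k} = min k CARD('n)"
proof -
  have "position ` {i :: 'n. position i \<le> k} = range (position :: 'n \<Rightarrow> nat) \<inter> {..k}"
    by auto
  also have "\<dots> = {1..min k CARD('n)}"
    by (auto simp: range_position)
  finally have "card (position ` {i :: 'n. position i \<le> k}) = min k CARD('n)"
    by simp
  then show ?thesis
    by (simp add: card_image inj_on_def position_eq_iff)
qed

definition prefix_sum :: "real ^ 'n::{finite,linorder} \<Rightarrow> nat \<Rightarrow> real" where
  "prefix_sum x k = (\<Sum>i | position i \<le> k. x $ i)"

text \<open>\<open>descent x k\<close> is \<open>x\<^sub>k - x\<^sub>k\<^sub>+\<^sub>1\<close>, with \<open>x\<^sub>k\<^sub>+\<^sub>1 = 0\<close> for the last index \<open>k\<close>.\<close>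

definition descent :: "real ^ 'n::{finite,linorder} \<Rightarrow> nat \<Rightarrow> real" where
  "descent x k = 2 * prefix_sum x k - prefix_sum x (k - 1) - prefix_sum x (Suc k)"

definition gap :: "'n::{finite,linorder} point \<Rightarrow> nat \<Rightarrow> real" where
  "gap w k = prefix_sum (fst w) k - prefix_sum (snd w) k"

datatype kostka_constraint = Descent_Fst nat | Descent_Snd nat | Gap nat

primrec slack :: "kostka_constraint \<Rightarrow> 'n::{finite,linorder} point \<Rightarrow> real" where
  "slack (Descent_Fst k) w = descent (fst w) k"
| "slack (Descent_Snd k) w = descent (snd w) k"
| "slack (Gap k) w = gap w k"

definition kostka_constraints :: "nat \<Rightarrow> kostka_constraint set" where
  "kostka_constraints r = Descent_Fst ` {1..r} \<union> Descent_Snd ` {1..r} \<union> Gap ` {1..r}"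

lemma mem_kostka_constraints [simp]:
  "Descent_Fst k \<in> kostka_constraints r \<longleftrightarrow> k \<in> {1..r}"
  "Descent_Snd k \<in> kostka_constraints r \<longleftrightarrow> k \<in> {1..r}"
  "Gap k \<in> kostka_constraints r \<longleftrightarrow> k \<in> {1..r}"
  by (auto simp: kostka_constraints_def)

definition dominance_cone :: "'n::{finite,linorder} point set" where
  "dominance_cone = {w. gap w CARD('n) = 0 \<and> (\<forall>c\<in>kostka_constraints CARD('n). 0 \<le> slack c w)}"

lemma prefix_sum_combination:
  "prefix_sum (s *\<^sub>R x + t *\<^sub>R y) k = s * prefix_sum x k + t * prefix_sum y k"
  by (simp add: prefix_sum_def sum.distrib sum_distrib_left)

lemma prefix_sum_scaleR: "prefix_sum (s *\<^sub>R x) k = s * prefix_sum x k"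
  by (simp add: prefix_sum_def sum_distrib_left)

lemma descent_combination:
  "descent (s *\<^sub>R x + t *\<^sub>R y) k = s * descent x k + t * descent y k"
  by (simp add: descent_def prefix_sum_combination algebra_simps)

lemma descent_scaleR: "descent (s *\<^sub>R x) k = s * descent x k"
  by (simp add: descent_def prefix_sum_scaleR algebra_simps)

lemma gap_combination: "gap (s *\<^sub>R w + t *\<^sub>R z) k = s * gap w k + t * gap z k"
  by (simp add: gap_def prefix_sum_combination algebra_simps)

lemma gap_scaleR: "gap (s *\<^sub>R w) k = s * gap w k"
  by (simp add: gap_def prefix_sum_scaleR algebra_simps)

lemma slack_combination: "slack c (s *\<^sub>R w + t *\<^sub>R z) = s * slack c w + t * slack c z"
  by (cases c) (simp_all add: gap_combination descent_combination)

lemma slack_scaleR: "slack c (s *\<^sub>R w) = s * slack c w"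
  by (cases c) (simp_all add: gap_scaleR descent_scaleR)

lemma linear_slack: "linear (slack c)"
  using slack_combination[of c 1 _ 1] by (intro linearI) (simp_all add: slack_scaleR)

lemma prefix_sum_0: "prefix_sum x 0 = 0"
proof -
  have "\<not> position i \<le> 0" for i :: 'a
    using position_in[of i] by simp
  then show ?thesis
    by (simp only: prefix_sum_def Collect_empty_eq sum.empty) simp
qed

lemma prefix_sum_top:
  fixes x :: "real ^ 'n::{finite,linorder}"
  assumes "CARD('n) \<le> k"
  shows "prefix_sum x k = (\<Sum>i\<in>UNIV. x $ i)"
proof -
  have "position i \<le> k" for i :: 'n
    using position_in[of i] assms by simp
  then show ?thesis by (simp add: prefix_sum_def)
qed

lemma prefix_sum_position:
  "prefix_sum x (position i) = prefix_sum x (position i - 1) + x $ i"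
proof -
  have "{j. position j \<le> position i} = insert i {j. position j \<le> position i - 1}"
    using position_in[of i] by (auto simp: position_eq_iff[symmetric])
  moreover have "i \<notin> {j. position j \<le> position i - 1}"
    using position_in[of i] by auto
  ultimately show ?thesis by (simp add: prefix_sum_def)
qed

lemma gap_second_difference:
  "gap w (k - 1) + gap w (Suc k) = 2 * gap w k - descent (fst w) k + descent (snd w) k"
  by (simp add: gap_def descent_def)

lemma nth_eq_sum_descent:
  fixes x :: "real ^ 'n::{finite,linorder}"
  shows "x $ i = (\<Sum>k = position i..CARD('n). descent x k)"
proof -
  let ?d = "\<lambda>k. prefix_sum x k - prefix_sum x (k - 1)"
  have "(\<Sum>k = position i..CARD('n). descent x k) = (\<Sum>k = position i..CARD('n). ?d k - ?d (k + 1))"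
    by (simp add: descent_def algebra_simps)
  also have "\<dots> = ?d (position i) - ?d (CARD('n) + 1)"
    using position_in[of i] by (subst sum_natinterval_diff) simp
  also have "\<dots> = x $ i"
    by (simp add: prefix_sum_position prefix_sum_top)
  finally show ?thesis ..
qed

lemma descent_nonneg_iff:
  fixes x :: "real ^ 'n::{finite,linorder}"
  shows "(\<forall>k\<in>{1..CARD('n)}. 0 \<le> descent x k) \<longleftrightarrow>
    (\<forall>i j. i \<le> j \<longrightarrow> x $ j \<le> x $ i) \<and> (\<forall>i. 0 \<le> x $ i)" (is "?descents \<longleftrightarrow> ?decreasing")
proof
  assume nonneg: ?descents
  have "x $ j \<le> x $ i" if "i \<le> j" for i j
    unfolding nth_eq_sum_descent using that nonneg position_in[of i]
    by (intro sum_mono2) (auto simp: position_le_iff[symmetric])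
  moreover have "0 \<le> x $ i" for i
    unfolding nth_eq_sum_descent using nonneg position_in[of i] by (intro sum_nonneg) auto
  ultimately show ?decreasing by blast
next
  assume decreasing: ?decreasing
  show ?descents
  proof
    fix k assume k: "k \<in> {1..CARD('n)}"
    then obtain i :: 'n where i: "position i = k" by (rule ex_position)
    show "0 \<le> descent x k"
    proof (cases "k = CARD('n)")
      case True
      have "x $ i = descent x k"
        by (simp add: nth_eq_sum_descent[of x i] i True)
      with decreasing show ?thesis by metis
    next
      case False
      with k have "Suc k \<in> {1..CARD('n)}" by simp
      then obtain j :: 'n where j: "position j = Suc k" by (rule ex_position)
      have "x $ i = descent x k + x $ j"
        using k by (simp add: nth_eq_sum_descent[of x] i j sum.atLeast_Suc_atMost)
      moreover have "x $ j \<le> x $ i"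
        using decreasing i j by (simp add: position_le_iff[symmetric])
      ultimately show ?thesis by linarith
    qed
  qed
qed

lemma gap_kostka_point:
  "gap (kostka_point p q) (position i) = real (\<Sum>j | j \<le> i. p $ j) - real (\<Sum>j | j \<le> i. q $ j)"
  by (simp add: gap_def kostka_point_def prefix_sum_def position_le_iff)

lemma gap_kostka_point_top:
  fixes p q :: "nat ^ 'n::{finite,linorder}"
  shows "gap (kostka_point p q) CARD('n) = real (\<Sum>j\<in>UNIV. p $ j) - real (\<Sum>j\<in>UNIV. q $ j)"
  by (simp add: gap_def kostka_point_def prefix_sum_top)

lemma kostka_point_in_dominance_cone_iff:
  fixes p q :: "nat ^ 'n::{finite,linorder}"
  shows "kostka_point p q \<in> dominance_cone \<longleftrightarrow> (\<exists>n. p \<in> Par n \<and> q \<in> Par n \<and> dominates p q)"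
proof -
  let ?w = "kostka_point p q"
  have "(\<forall>k\<in>{1..CARD('n)}. 0 \<le> gap ?w k) \<longleftrightarrow> dominates p q"
    unfolding range_position[symmetric] by (simp add: gap_kostka_point dominates_def del: of_nat_sum)
  moreover have "(\<forall>k\<in>{1..CARD('n)}. 0 \<le> descent (fst ?w) k) \<longleftrightarrow> (\<forall>i j. i \<le> j \<longrightarrow> p $ j \<le> p $ i)"
    "(\<forall>k\<in>{1..CARD('n)}. 0 \<le> descent (snd ?w) k) \<longleftrightarrow> (\<forall>i j. i \<le> j \<longrightarrow> q $ j \<le> q $ i)"
    unfolding descent_nonneg_iff by (simp_all add: kostka_point_def)
  moreover have "gap ?w CARD('n) = 0 \<longleftrightarrow> (\<Sum>j\<in>UNIV. p $ j) = (\<Sum>j\<in>UNIV. q $ j)"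
    unfolding gap_kostka_point_top by (simp del: of_nat_sum)
  ultimately show ?thesis
    by (auto simp: dominance_cone_def kostka_constraints_def ball_Un Par_def)
qed

lemma kostka_cone_eq:
  "kostka_cone = convex hull {kostka_point p q | p q. kostka_point p q \<in> dominance_cone}"
proof -
  have "{kostka_point p q | p q n. p \<in> Par n \<and> q \<in> Par n \<and> dominates p q} =
      {kostka_point p q | p q. kostka_point p q \<in> dominance_cone}"
    unfolding kostka_point_in_dominance_cone_iff by blast
  then show ?thesis unfolding kostka_cone_def by (rule arg_cong)
qed

lemma convex_dominance_cone: "convex dominance_cone"
proof (rule convexI)
  fix w z :: "'a point" and s t :: real
  assume "w \<in> dominance_cone" "z \<in> dominance_cone" "0 \<le> s" "0 \<le> t"
  then show "s *\<^sub>R w + t *\<^sub>R z \<in> dominance_cone"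
    by (simp add: dominance_cone_def gap_combination slack_combination)
qed

lemma scaleR_in_dominance_cone:
  "w \<in> dominance_cone \<Longrightarrow> 0 \<le> s \<Longrightarrow> s *\<^sub>R w \<in> dominance_cone"
  by (simp add: dominance_cone_def gap_scaleR slack_scaleR)

lemma kostka_cone_subset_dominance_cone: "kostka_cone \<subseteq> dominance_cone"
  unfolding kostka_cone_eq by (intro hull_minimal convex_dominance_cone) auto

lemma convex_kostka_cone: "convex kostka_cone"
  unfolding kostka_cone_def by (rule convex_convex_hull)

lemma of_nat_scaleR_in_kostka_cone:
  fixes w :: "'n::{finite,linorder} point"
  assumes "w \<in> kostka_cone"
  shows "real n *\<^sub>R w \<in> kostka_cone"
proof -
  let ?S = "{kostka_point p q | p q. kostka_point p q \<in> dominance_cone} :: 'n point set"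
  have "real n *\<^sub>R z \<in> ?S" if generator: "z \<in> ?S" for z
  proof -
    obtain p q :: "(nat, 'n) vec" where z: "z = kostka_point p q" "z \<in> dominance_cone"
      using generator by blast
    then have "real n *\<^sub>R z = kostka_point (\<chi> i. n * p $ i) (\<chi> i. n * q $ i)"
      by (simp add: kostka_point_def vec_eq_iff)
    moreover have "real n *\<^sub>R z \<in> dominance_cone"
      using z by (simp add: scaleR_in_dominance_cone)
    ultimately show ?thesis by force
  qed
  then have "(*\<^sub>R) (real n) ` ?S \<subseteq> ?S" by blast
  then have "convex hull ((*\<^sub>R) (real n) ` ?S) \<subseteq> kostka_cone"
    unfolding kostka_cone_eq by (rule hull_mono)
  moreover have "real n *\<^sub>R w \<in> (*\<^sub>R) (real n) ` (convex hull ?S)"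
    using assms by (intro imageI) (simp add: kostka_cone_eq)
  ultimately show ?thesis unfolding convex_hull_scaling by blast
qed

lemma cone_kostka_cone: "cone (kostka_cone :: 'n::{finite,linorder} point set)"
  unfolding cone_def
proof (intro ballI allI impI)
  fix w :: "'n point" and s :: real
  assume w: "w \<in> kostka_cone" and s: "0 \<le> s"
  obtain n where n: "s < real n" using reals_Archimedean2 by blast
  have "(s / real n) *\<^sub>R (real n *\<^sub>R w) + (1 - s / real n) *\<^sub>R (real 0 *\<^sub>R w) \<in> kostka_cone"
    using s n by (intro convexD[OF convex_kostka_cone] of_nat_scaleR_in_kostka_cone w) simp_all
  then show "s *\<^sub>R w \<in> kostka_cone" using s n by simp
qed

definition half_sums :: "'n::{finite,linorder} point set" where
  "half_sums = {w. prefix_sum (fst w) CARD('n) = 1 / 2 \<and> prefix_sum (snd w) CARD('n) = 1 / 2}"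

lemma mem_half_sums:
  fixes w :: "'n::{finite,linorder} point"
  shows "w \<in> half_sums \<longleftrightarrow> prefix_sum (fst w) CARD('n) = 1 / 2 \<and> prefix_sum (snd w) CARD('n) = 1 / 2"
  by (simp add: half_sums_def)

interpretation kostka: linear_constraints
  "half_sums :: 'n::{finite,linorder} point set" slack "kostka_constraints CARD('n)"
proof (rule linear_constraints.intro)
  show "affine (half_sums :: 'n point set)"
    by (auto simp: affine_def half_sums_def prefix_sum_combination field_simps)
  show "finite (kostka_constraints CARD('n))"
    by (simp add: kostka_constraints_def)
qed (rule linear_slack)

lemma kostka_feasible_iff_dominance_cone:
  fixes w :: "'n::{finite,linorder} point"
  shows "w \<in> kostka.feasible \<longleftrightarrow> w \<in> dominance_cone \<and> (\<Sum>i\<in>UNIV. fst w $ i + snd w $ i) = 1"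
  by (auto simp: kostka.feasible_def dominance_cone_def mem_half_sums gap_def prefix_sum_top sum.distrib)

lemma kostka_feasible_nonneg:
  fixes w :: "'n::{finite,linorder} point"
  assumes "w \<in> kostka.feasible" "k \<in> {1..CARD('n)}"
  shows "0 \<le> descent (fst w) k" "0 \<le> descent (snd w) k" "0 \<le> gap w k"
proof -
  have nonneg: "0 \<le> slack c w" if "c \<in> kostka_constraints CARD('n)" for c
    using assms(1) that by (simp add: kostka.feasible_def)
  show "0 \<le> descent (fst w) k" "0 \<le> descent (snd w) k" "0 \<le> gap w k"
    using nonneg[of "Descent_Fst k"] nonneg[of "Descent_Snd k"] nonneg[of "Gap k"] assms(2) by simp_all
qed

lemma bounded_kostka_feasible: "bounded (kostka.feasible :: 'n::{finite,linorder} point set)"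
proof -
  have norm_le: "norm x \<le> (\<Sum>i\<in>UNIV. x $ i)"
    if "\<forall>k\<in>{1..CARD('n)}. 0 \<le> descent x k" for x :: "(real, 'n) vec"
  proof -
    have "\<forall>i. 0 \<le> x $ i" using that unfolding descent_nonneg_iff by blast
    then show ?thesis using norm_le_l1_cart[of x] by simp
  qed
  have "norm w \<le> 1" if "w \<in> kostka.feasible" for w :: "'n point"
  proof -
    have "norm w \<le> norm (fst w) + norm (snd w)"
      using norm_Pair_le[of "fst w" "snd w"] by simp
    also have "\<dots> \<le> (\<Sum>i\<in>UNIV. fst w $ i) + (\<Sum>i\<in>UNIV. snd w $ i)"
      using kostka_feasible_nonneg[OF that] by (intro add_mono norm_le) blast+
    also have "\<dots> = 1"
      using that by (simp add: kostka_feasible_iff_dominance_cone sum.distrib)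
    finally show ?thesis .
  qed
  then show ?thesis unfolding bounded_iff by blast
qed

lemma compact_kostka_feasible: "compact (kostka.feasible :: 'n::{finite,linorder} point set)"
  using bounded_kostka_feasible kostka.closed_feasible compact_eq_bounded_closed by blast

section \<open>Labels and vertices\<close>

definition labels :: "nat \<Rightarrow> (nat \<times> nat \<times> nat) set" where
  "labels r = {(a, b, l). (l < b \<and> b < a \<or> 0 < a \<and> b = a \<and> l = a) \<and> a \<le> r}"

definition label_support :: "nat \<times> nat \<times> nat \<Rightarrow> kostka_constraint set" where
  "label_support = (\<lambda>(a, b, l).
     {Descent_Fst b} \<union> Descent_Snd ` ({a, l} - {0}) \<union> Gap ` {l<..<a})"

definition ray_label :: "nat \<Rightarrow> nat \<Rightarrow> nat \<Rightarrow> nat \<times> nat \<times> nat" where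
  "ray_label a b m = (a, b, if a = b then a else m)"

lemma mem_label_support [simp]:
  "Descent_Fst k \<in> label_support (a, b, l) \<longleftrightarrow> k = b"
  "Descent_Snd k \<in> label_support (a, b, l) \<longleftrightarrow> k \<noteq> 0 \<and> (k = a \<or> k = l)"
  "Gap k \<in> label_support (a, b, l) \<longleftrightarrow> l < k \<and> k < a"
  by (auto simp: label_support_def)

lemma label_support_subset_iff:
  "label_support (a, b, l) \<subseteq> S \<longleftrightarrow>
    Descent_Fst b \<in> S \<and> (\<forall>k\<in>{a, l} - {0}. Descent_Snd k \<in> S) \<and> (\<forall>k\<in>{l<..<a}. Gap k \<in> S)"
  by (auto simp: label_support_def)

lemma ex_positive_descent:
  fixes w :: "'n::{finite,linorder} point"
  assumes w: "w \<in> kostka.feasible"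
  obtains b where "b \<in> {1..CARD('n)}" "0 < descent (fst w) b"
proof (rule ccontr)
  assume "\<not> thesis"
  with that have "descent (fst w) k = 0" if k: "k \<in> {1..CARD('n)}" for k
    using kostka_feasible_nonneg(1)[OF w k] k by (metis less_le)
  then have "fst w $ i = 0" for i
    using position_in[of i] by (simp add: nth_eq_sum_descent[of _ i])
  then have "prefix_sum (fst w) CARD('n) = 0" by (simp add: prefix_sum_def)
  with w show False by (simp add: kostka.feasible_def mem_half_sums)
qed

lemma gap_outside:
  fixes w :: "'n::{finite,linorder} point"
  assumes "w \<in> kostka.feasible" "k = 0 \<or> CARD('n) \<le> k"
  shows "gap w k = 0"
  using assms by (auto simp: kostka.feasible_def mem_half_sums gap_def prefix_sum_0 prefix_sum_top)

lemma gap_nonneg: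
  fixes w :: "'n::{finite,linorder} point"
  assumes "w \<in> kostka.feasible"
  shows "0 \<le> gap w k"
proof (cases "k = 0 \<or> CARD('n) \<le> k")
  case False
  then show ?thesis using assms by (intro kostka_feasible_nonneg(3)) auto
qed (simp add: gap_outside[OF assms])

lemma ex_positivity_interval:
  fixes g :: "nat \<Rightarrow> real"
  assumes nonneg: "\<And>k. 0 \<le> g k" and g: "g 0 = 0" "g r = 0" "0 < g b" and "b < r"
  obtains l a where "l < b" "b < a" "a \<le> r" "g l = 0" "g a = 0" "\<And>k. l < k \<Longrightarrow> k < a \<Longrightarrow> 0 < g k"
proof -
  define a where "a = (LEAST k. b < k \<and> g k = 0)"
  define l where "l = (GREATEST k. k < b \<and> g k = 0)"
  have a: "b < a \<and> g a = 0"
    unfolding a_def by (rule LeastI[of _ r]) (use g \<open>b < r\<close> in simp)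
  have a_le: "a \<le> k" if "b < k" "g k = 0" for k
    unfolding a_def by (rule Least_le) (use that in simp)
  have "0 < b" using g by (cases b) auto
  have l: "l < b \<and> g l = 0"
    unfolding l_def by (rule GreatestI_nat[of _ 0 b]) (use g \<open>0 < b\<close> in auto)
  have le_l: "k \<le> l" if "k < b" "g k = 0" for k
    unfolding l_def by (rule Greatest_le_nat[of _ k b]) (use that in auto)
  have "0 < g k" if k: "l < k" "k < a" for k
  proof (rule ccontr)
    assume "\<not> 0 < g k"
    with nonneg[of k] have zero: "g k = 0" by simp
    with g(3) have "k \<noteq> b" by auto
    with k zero show False using a_le[of k] le_l[of k] by (cases "k < b") simp_all
  qed
  then show thesis
    using a l a_le[of r] g \<open>b < r\<close> by (intro that[of l a]) simp_all
qed

lemma Descent_Snd_in_support: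
  fixes w :: "'n::{finite,linorder} point"
  assumes "k \<in> {1..CARD('n)}" "gap w k = 0" "0 < gap w (k - 1) + gap w (Suc k) + descent (fst w) k"
  shows "Descent_Snd k \<in> kostka.support w"
  using assms gap_second_difference[of w k] by (simp add: kostka.support_def)

lemma label_support_subset_of_positivity_interval:
  fixes w :: "'n::{finite,linorder} point"
  assumes w: "w \<in> kostka.feasible" and b: "0 < descent (fst w) b"
    and interval: "l < b" "b < a" "a \<le> CARD('n)" "gap w l = 0" "gap w a = 0"
    and pos: "\<And>k. l < k \<Longrightarrow> k < a \<Longrightarrow> 0 < gap w k"
  shows "label_support (a, b, l) \<subseteq> kostka.support w"
proof -
  have "Descent_Fst b \<in> kostka.support w"
    using b interval by (simp add: kostka.support_def)
  moreover have "Descent_Snd a \<in> kostka.support w"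
  proof (rule Descent_Snd_in_support)
    have "0 < gap w (a - 1)" using interval by (intro pos) auto
    then show "0 < gap w (a - 1) + gap w (Suc a) + descent (fst w) a"
      using interval gap_nonneg[OF w, of "Suc a"] kostka_feasible_nonneg(1)[OF w, of a] by simp
  qed (use interval in simp_all)
  moreover have "Descent_Snd l \<in> kostka.support w" if "l \<noteq> 0"
  proof (rule Descent_Snd_in_support)
    have "0 < gap w (Suc l)" using interval by (intro pos) auto
    then show "0 < gap w (l - 1) + gap w (Suc l) + descent (fst w) l"
      using interval that gap_nonneg[OF w, of "l - 1"] kostka_feasible_nonneg(1)[OF w, of l] by simp
  qed (use interval that in simp_all)
  moreover have "Gap k \<in> kostka.support w" if "l < k" "k < a" for k
    using pos[OF that] that interval by (simp add: kostka.support_def)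
  ultimately show ?thesis by (auto simp: label_support_subset_iff)
qed

lemma ex_label_support_subset:
  fixes w :: "'n::{finite,linorder} point"
  assumes w: "w \<in> kostka.feasible"
  obtains x where "x \<in> labels CARD('n)" "label_support x \<subseteq> kostka.support w"
proof -
  obtain b where b: "b \<in> {1..CARD('n)}" "0 < descent (fst w) b"
    using ex_positive_descent[OF w] .
  show thesis
  proof (cases "gap w b = 0")
    case True
    with b have "Descent_Snd b \<in> kostka.support w"
      using gap_nonneg[OF w] by (intro Descent_Snd_in_support) (simp_all add: add_nonneg_pos)
    with b have "(b, b, b) \<in> labels CARD('n)" "label_support (b, b, b) \<subseteq> kostka.support w"
      by (auto simp: labels_def label_support_subset_iff kostka.support_def)
    then show thesis by (rule that)
  next
    case False
    then have "0 < gap w b" "b < CARD('n)"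
      using gap_nonneg[OF w, of b] gap_outside[OF w, of b] b(1) by (auto simp: less_le)
    then obtain l a where interval: "l < b" "b < a" "a \<le> CARD('n)" "gap w l = 0" "gap w a = 0"
      and pos: "\<And>k. l < k \<Longrightarrow> k < a \<Longrightarrow> 0 < gap w k"
      using ex_positivity_interval[of "gap w" "CARD('n)" b] gap_nonneg[OF w] gap_outside[OF w] by auto
    then have "(a, b, l) \<in> labels CARD('n)" by (simp add: labels_def)
    then show thesis
      using label_support_subset_of_positivity_interval[OF w b(2) interval pos] by (rule that)
  qed
qed

definition fundamental_weight :: "nat \<Rightarrow> real ^ 'n::{finite,linorder}" where
  "fundamental_weight b = (\<chi> i. if position i \<le> b then 1 else 0)"

lemma prefix_sum_fundamental_weight:
  assumes "b \<le> CARD('n)"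
  shows "prefix_sum (fundamental_weight b :: real ^ 'n::{finite,linorder}) k = real (min k b)"
proof -
  have "prefix_sum (fundamental_weight b :: (real, 'n) vec) k = (\<Sum>i :: 'n | position i \<le> min k b. 1)"
    unfolding prefix_sum_def fundamental_weight_def
    by (rule sum.mono_neutral_cong_right) auto
  also have "\<dots> = real (min k b)"
    using assms card_position_le[of "min k b", where 'n='n] by (simp del: min.bounded_iff)
  finally show ?thesis .
qed

lemma descent_fundamental_weight:
  assumes "b \<le> CARD('n)" "1 \<le> k"
  shows "descent (fundamental_weight b :: real ^ 'n::{finite,linorder}) k = (if k = b then 1 else 0)"
proof -
  consider "k < b" | "k = b" | "b < k" by linarith
  then show ?thesis
    using assms by cases (auto simp: descent_def prefix_sum_fundamental_weight min_def of_nat_diff)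
qed

lemma fst_ray_vector: "fst (ray_vector a b m) = (real a - real m) *\<^sub>R fundamental_weight b"
  by (auto simp: ray_vector_def fundamental_weight_def vec_eq_iff)

lemma snd_ray_vector:
  "m \<le> a \<Longrightarrow> snd (ray_vector a b m) =
    (real a - real b) *\<^sub>R fundamental_weight m + (real b - real m) *\<^sub>R fundamental_weight a"
  by (auto simp: ray_vector_def fundamental_weight_def vec_eq_iff)

lemma gap_ray_vector:
  assumes "m < b" "b \<le> a" "a \<le> CARD('n)"
  shows "gap (ray_vector a b m :: 'n::{finite,linorder} point) k =
    (if k \<le> m \<or> a \<le> k then 0
     else if k \<le> b then (real a - real b) * (real k - real m)
     else (real b - real m) * (real a - real k))"
  using assms
  by (auto simp: gap_def fst_ray_vector snd_ray_vector prefix_sum_combination prefix_sum_scaleR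
        prefix_sum_fundamental_weight min_def) (simp_all add: algebra_simps)

lemma slack_ray_vector:
  assumes m: "m < b" "b \<le> a" "a \<le> CARD('n)" and c: "c \<in> kostka_constraints CARD('n)"
  shows "0 \<le> slack c (ray_vector a b m :: 'n::{finite,linorder} point)"
    and "slack c (ray_vector a b m :: 'n point) \<noteq> 0 \<longleftrightarrow> c \<in> label_support (ray_label a b m)"
proof -
  let ?w = "ray_vector a b m :: 'n point"
  consider (Fst) k where "c = Descent_Fst k" "1 \<le> k" | (Snd) k where "c = Descent_Snd k" "1 \<le> k"
    | (Gap) k where "c = Gap k" "1 \<le> k"
    using c by (auto simp: kostka_constraints_def)
  then have "0 \<le> slack c ?w \<and> (slack c ?w \<noteq> 0 \<longleftrightarrow> c \<in> label_support (ray_label a b m))"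
  proof cases
    case Fst
    then have "slack c ?w = (if k = b then real a - real m else 0)"
      using m by (simp add: fst_ray_vector descent_scaleR descent_fundamental_weight)
    with Fst m show ?thesis by (auto simp: ray_label_def)
  next
    case Snd
    then have "slack c ?w = (if k = m then real a - real b else 0) + (if k = a then real b - real m else 0)"
      using m by (simp add: snd_ray_vector descent_combination descent_fundamental_weight)
    with Snd m show ?thesis by (auto simp: ray_label_def)
  next
    case Gap
    with m show ?thesis by (auto simp: gap_ray_vector ray_label_def)
  qed
  then show "0 \<le> slack c ?w" "slack c ?w \<noteq> 0 \<longleftrightarrow> c \<in> label_support (ray_label a b m)"
    by blast+
qed

lemma support_ray_vector:
  assumes "m < b" "b \<le> a" "a \<le> CARD('n)"
  shows "kostka.support (ray_vector a b m :: 'n::{finite,linorder} point) =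
    label_support (ray_label a b m)"
proof -
  have "label_support (ray_label a b m) \<subseteq> kostka_constraints CARD('n)"
    using assms by (auto simp: ray_label_def label_support_subset_iff split: if_splits)
  then show ?thesis
    using slack_ray_vector(2)[OF assms] unfolding kostka.support_def by blast
qed

lemma ray_vector_in_kostka_cone:
  assumes m: "m < b" "b \<le> a" "a \<le> CARD('n)"
  shows "(ray_vector a b m :: 'n::{finite,linorder} point) \<in> kostka_cone"
proof -
  let ?p = "\<chi> i. if position i \<le> b then a - m else 0 :: (nat, 'n) vec"
  let ?q = "\<chi> i. if position i \<le> m then a - m else if position i \<le> a then b - m else 0 :: (nat, 'n) vec"
  have "ray_vector a b m = kostka_point ?p ?q"
    using m by (auto simp: kostka_point_def ray_vector_def vec_eq_iff of_nat_diff)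
  moreover have "(ray_vector a b m :: 'n point) \<in> dominance_cone"
    using m slack_ray_vector(1)[OF m] by (simp add: dominance_cone_def gap_ray_vector)
  ultimately show ?thesis
    unfolding kostka_cone_eq by (intro hull_inc) auto
qed

text \<open>The choice of \<open>m = 0\<close> for the labels \<open>(a, a, a)\<close> is arbitrary; \<open>m = a\<close> would give the zero vector.\<close>

definition vertex :: "nat \<times> nat \<times> nat \<Rightarrow> 'n::{finite,linorder} point" where
  "vertex = (\<lambda>(a, b, l). let m = if a = b then 0 else l in
     (1 / (2 * real b * (real a - real m))) *\<^sub>R ray_vector a b m)"

lemma vertex_eq_scaled_ray_vector:
  assumes "m < b" "b \<le> a"
  shows "vertex (ray_label a b m) =
    (1 / (2 * real b * (real a - real m))) *\<^sub>R ray_vector a b m"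
proof (rule prod_eqI)
  show "fst (vertex (ray_label a b m)) =
      fst ((1 / (2 * real b * (real a - real m))) *\<^sub>R ray_vector a b m)"
    using assms by (simp add: vertex_def ray_label_def Let_def fst_ray_vector)
  show "snd (vertex (ray_label a b m)) =
      snd ((1 / (2 * real b * (real a - real m))) *\<^sub>R ray_vector a b m)"
    using assms by (simp add: vertex_def ray_label_def Let_def snd_ray_vector)
qed

lemma labels_cases:
  assumes "x \<in> labels r"
  obtains (ray) a b m where "m < b" "b \<le> a" "a \<le> r" "x = ray_label a b m"
proof -
  obtain a b l where x: "x = (a, b, l)" by (cases x)
  show thesis
  proof (cases "a = b")
    case True
    with assms x show thesis by (intro that[of 0 b a]) (auto simp: labels_def ray_label_def)
  next
    case False
    with assms x show thesis by (intro that[of l b a]) (auto simp: labels_def ray_label_def)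
  qed
qed

lemma support_vertex:
  assumes "x \<in> labels CARD('n)"
  shows "kostka.support (vertex x :: 'n::{finite,linorder} point) = label_support x"
  using assms
proof (cases rule: labels_cases)
  case (ray a b m)
  then show ?thesis
    by (simp add: vertex_eq_scaled_ray_vector kostka.support_scaleR support_ray_vector)
qed

lemma vertex_in_kostka_cone:
  assumes "x \<in> labels CARD('n)"
  shows "(vertex x :: 'n::{finite,linorder} point) \<in> kostka_cone"
  using assms
proof (cases rule: labels_cases)
  case (ray a b m)
  then have "(1 / (2 * real b * (real a - real m))) *\<^sub>R ray_vector a b m \<in> (kostka_cone :: 'n point set)"
    by (intro mem_cone[OF cone_kostka_cone] ray_vector_in_kostka_cone) simp_all
  with ray show ?thesis
    by (simp add: vertex_eq_scaled_ray_vector)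
qed

lemma vertex_feasible:
  assumes "x \<in> labels CARD('n)"
  shows "(vertex x :: 'n::{finite,linorder} point) \<in> kostka.feasible"
proof -
  have "(vertex x :: 'n point) \<in> dominance_cone"
    using vertex_in_kostka_cone[OF assms] kostka_cone_subset_dominance_cone by blast
  moreover have "prefix_sum (fst (vertex x :: 'n point)) CARD('n) = 1 / 2"
    using assms
  proof (cases rule: labels_cases)
    case (ray a b m)
    then show ?thesis
      by (simp add: vertex_eq_scaled_ray_vector fst_ray_vector prefix_sum_scaleR
          prefix_sum_fundamental_weight)
  qed
  ultimately show ?thesis
    by (simp add: kostka.feasible_def dominance_cone_def mem_half_sums gap_def)
qed

lemma labeled_imp_vertex:
  fixes w :: "'n::{finite,linorder} point"
  assumes w: "w \<in> kostka.feasible" and "labeled w x"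
  shows "x \<in> labels CARD('n)" "w = vertex x"
proof -
  obtain a b m where m: "m < b" "b \<le> a" "a \<le> CARD('n)" "x = ray_label a b m"
    and "w \<in> cone hull {ray_vector a b m}"
    using assms(2) unfolding labeled_def ray_label_def by (cases x) force
  then obtain c where c: "w = c *\<^sub>R ray_vector a b m"
    by (auto simp: cone_hull_expl simp del: scaleR_Pair split_paired_Ex)
  have "prefix_sum (fst w) CARD('n) = 1 / 2"
    using w by (simp add: kostka.feasible_def mem_half_sums)
  then have "c * ((real a - real m) * real b) = 1 / 2"
    using m by (simp add: c fst_ray_vector prefix_sum_scaleR prefix_sum_fundamental_weight)
  then have "c = 1 / (2 * real b * (real a - real m))"
    using m by (simp add: field_simps)
  then show "w = vertex x"
    using m c by (simp add: vertex_eq_scaled_ray_vector)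
  show "x \<in> labels CARD('n)"
    using m by (auto simp: labels_def ray_label_def)
qed

section \<open>Edges\<close>

lemma label_support_subset_UnD:
  assumes "label_support (A, B, L) \<subseteq> label_support (a, b, l) \<union> label_support (a', b', l')"
    and "(A, B, L) \<in> labels r"
  shows "B = b \<or> B = b'" "A = a \<or> A = l \<or> A = a' \<or> A = l'"
    and "L = 0 \<or> L = a \<or> L = l \<or> L = a' \<or> L = l'"
    and "L < k \<Longrightarrow> k < A \<Longrightarrow> l < k \<and> k < a \<or> l' < k \<and> k < a'"
  using assms by (auto simp: label_support_subset_iff labels_def)

lemma label_support_subset_Un_diagonal:
  assumes z: "(A, B, L) \<in> labels r" and y: "(a', b', l') \<in> labels r"
    and sub: "label_support (A, B, L) \<subseteq> label_support (a, a, a) \<union> label_support (a', b', l')"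
    and adjacent: "a' = b' \<or> a = b' \<or> a' \<le> a \<or> a \<le> l'"
  shows "(A, B, L) \<in> {(a, a, a), (a', b', l')}"
proof -
  note entries = label_support_subset_UnD[OF sub z]
  have y_cases: "l' < b' \<and> b' < a' \<or> a' = b' \<and> l' = b'" using y by (auto simp: labels_def)
  consider (proper) "L < B" "B < A" | (diagonal) "A = B" "L = B" using z by (auto simp: labels_def)
  then show ?thesis
  proof cases
    case proper
    then have B_between: "l' < B" "B < a'" using entries(4)[of B] by auto
    then have y_order: "l' < b'" "b' < a'" using y_cases by linarith+
    have le: "l' \<le> L" "A \<le> a'"
      using entries(4)[of l'] entries(4)[of a'] proper B_between by linarith+
    have "B = b'" using entries(1) adjacent y_order B_between by linarith
    moreover have "A = a'" using entries(2) adjacent proper le y_order calculation by linarith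
    moreover have "L = l'" using entries(3) adjacent proper le y_order \<open>B = b'\<close> by linarith
    ultimately show ?thesis by simp
  next
    case diagonal
    then have "B = a \<or> B = b' \<and> (b' = a' \<or> b' = l' \<or> b' = a)" using entries(1,2) by blast
    with diagonal y_cases show ?thesis by auto
  qed
qed

lemma label_support_subset_Un_two_common:
  assumes z: "(A, B, L) \<in> labels r" and order: "l < b" "b < a" "l' < b'" "b' < a'"
    and sub: "label_support (A, B, L) \<subseteq> label_support (a, b, l) \<union> label_support (a', b', l')"
    and common: "a = a' \<and> b = b' \<or> a = a' \<and> l = l' \<or> b = b' \<and> l = l'"
  shows "(A, B, L) \<in> {(a, b, l), (a', b', l')}"
proof -
  note entries = label_support_subset_UnD[OF sub z]
  have around: "l < B" "l' < B" "B < a" "B < a'" using entries(1) order common by auto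
  then have "L < B" "B < A" using z entries(2) by (auto simp: labels_def)
  moreover from this have "min l l' \<le> L" using entries(4)[of "min l l'"] around by linarith
  ultimately have "A = a \<or> A = a'" "L = l \<or> L = l'" using entries(2,3) around by linarith+
  with entries(1) common show ?thesis by auto
qed

lemma label_support_subset_Un_separated:
  assumes z: "(A, B, L) \<in> labels r" and order: "l < b" "b < a" "l' < b'" "b' < a'"
    and sub: "label_support (A, B, L) \<subseteq> label_support (a, b, l) \<union> label_support (a', b', l')"
    and separated: "a' \<le> l"
  shows "(A, B, L) \<in> {(a, b, l), (a', b', l')}"
proof -
  note entries = label_support_subset_UnD[OF sub z]
  have "B \<noteq> A" using entries(1,2) order separated by linarith
  then have between: "L < B" "B < A" using z by (auto simp: labels_def)
  consider (first) "B = b" | (second) "B = b'" using entries(1) by blast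
  then show ?thesis
  proof cases
    case first
    have "l \<le> L" "A \<le> a" using entries(4)[of l] entries(4)[of a] between order separated first by linarith+
    then have "A = a" "L = l" using entries(2,3) between order separated first by linarith+
    with first show ?thesis by simp
  next
    case second
    have "l' \<le> L" "A \<le> a'" using entries(4)[of l'] entries(4)[of a'] between order separated second by linarith+
    then have "A = a'" "L = l'" using entries(2,3) between order separated second by linarith+
    with second show ?thesis by simp
  qed
qed

lemma label_support_mono_imp_eq:
  assumes "x \<in> labels r" "z \<in> labels r" "label_support z \<subseteq> label_support x"
  shows "z = x"
proof -
  obtain a b l A B L where x: "x = (a, b, l)" and z: "z = (A, B, L)" by (metis prod_cases3)
  show ?thesis
  proof (cases "a = b")
    case True
    then have "l = a" using assms(1) by (auto simp: x labels_def)
    with True assms show ?thesis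
      using label_support_subset_Un_diagonal[of A B L r a b l a] by (simp add: x z)
  next
    case False
    then have "l < b" "b < a" using assms(1) by (auto simp: x labels_def)
    with assms show ?thesis
      using label_support_subset_Un_two_common[of A B L r l b a l b a] by (simp add: x z)
  qed
qed

definition adjacent_labels :: "nat \<times> nat \<times> nat \<Rightarrow> nat \<times> nat \<times> nat \<Rightarrow> bool" where
  "adjacent_labels = (\<lambda>(a, b, l) (a', b', l').
    (a = b \<and> (a' = b' \<or> a = b' \<or> a \<ge> a' \<or> l' \<ge> a)) \<or>
    (a \<noteq> b \<and>
      ((a = a' \<and> b = b' \<or> a = a' \<and> l = l' \<or> b = b' \<and> l = l') \<or> l \<ge> a' \<or> l' \<ge> a)))"

lemma adjacent_labels_imp_no_third_label:
  assumes labels: "(a, b, l) \<in> labels r" "(a', b', l') \<in> labels r" "z \<in> labels r"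
    and diff: "a - b \<le> a' - b'" and adjacent: "adjacent_labels (a, b, l) (a', b', l')"
    and sub: "label_support z \<subseteq> label_support (a, b, l) \<union> label_support (a', b', l')"
  shows "z \<in> {(a, b, l), (a', b', l')}"
proof -
  obtain A B L where z: "z = (A, B, L)" by (metis prod_cases3)
  show ?thesis
  proof (cases "a = b")
    case True
    then have "l = a" using labels by (auto simp: labels_def)
    with True show ?thesis
      using label_support_subset_Un_diagonal[of A B L r a' b' l' a] labels adjacent sub
      by (simp add: z adjacent_labels_def)
  next
    case False
    with labels diff have order: "l < b" "b < a" "l' < b'" "b' < a'"
      by (auto simp: labels_def)
    consider (two_common) "a = a' \<and> b = b' \<or> a = a' \<and> l = l' \<or> b = b' \<and> l = l'"
      | (above) "a' \<le> l" | (below) "a \<le> l'"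
      using adjacent False by (auto simp: adjacent_labels_def)
    then show ?thesis
    proof cases
      case two_common
      then show ?thesis
        using label_support_subset_Un_two_common labels(3) order sub unfolding z by blast
    next
      case above
      then show ?thesis
        using label_support_subset_Un_separated labels(3) order sub unfolding z by blast
    next
      case below
      moreover have "label_support z \<subseteq> label_support (a', b', l') \<union> label_support (a, b, l)"
        using sub by blast
      ultimately show ?thesis
        using label_support_subset_Un_separated labels(3) order unfolding z by blast
    qed
  qed
qed

lemma ex_third_label:
  assumes labels: "(a, b, l) \<in> labels r" "(a', b', l') \<in> labels r"
    and diff: "a - b \<le> a' - b'" and not_adjacent: "\<not> adjacent_labels (a, b, l) (a', b', l')"
  obtains z where "z \<in> labels r" "z \<notin> {(a, b, l), (a', b', l')}"
    "label_support z \<subseteq> label_support (a, b, l) \<union> label_support (a', b', l')"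
proof (cases "a = b")
  case True
  with assms show thesis
    by (intro that[of "(a', a, l')"]) (auto simp: labels_def adjacent_labels_def label_support_subset_iff)
next
  case False
  with labels diff have order: "l < b" "b < a" "l' < b'" "b' < a'" "a \<le> r" "a' \<le> r"
    by (auto simp: labels_def)
  have overlap: "l < a'" "l' < a" using not_adjacent False by (auto simp: adjacent_labels_def)
  show thesis
  proof (cases "b = b'")
    case True
    with False order diff not_adjacent show thesis
      by (intro that[of "(a, b, l')"]) (auto simp: labels_def adjacent_labels_def label_support_subset_iff)
  next
    case b_neq: False
    define merged where "merged c = (max a a', c, min l l')" for c :: nat
    have "merged b \<in> labels r" "merged b' \<in> labels r"
      using order by (auto simp: labels_def merged_def)
    moreover have "label_support (merged c) \<subseteq> label_support (a, b, l) \<union> label_support (a', b', l')"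
      if "c = b \<or> c = b'" for c
      using that overlap by (auto simp: label_support_subset_iff merged_def)
    moreover have "merged b \<noteq> (a, b, l) \<or> merged b' \<noteq> (a', b', l')"
      using not_adjacent False by (auto simp: adjacent_labels_def merged_def)
    moreover have "merged b \<noteq> (a', b', l')" "merged b' \<noteq> (a, b, l)"
      using b_neq by (simp_all add: merged_def)
    ultimately show thesis using that by blast
  qed
qed

lemma adjacent_labels_iff_no_third_label:
  assumes "(a, b, l) \<in> labels r" "(a', b', l') \<in> labels r" and "a - b \<le> a' - b'"
  shows "adjacent_labels (a, b, l) (a', b', l') \<longleftrightarrow>
    (\<forall>z\<in>labels r. label_support z \<subseteq> label_support (a, b, l) \<union> label_support (a', b', l') \<longrightarrow>
      z \<in> {(a, b, l), (a', b', l')})"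
  using adjacent_labels_imp_no_third_label[OF assms(1,2) _ assms(3)] ex_third_label[OF assms]
  by metis

lemma extreme_points_of_kostka_feasible:
  "{w :: 'n::{finite,linorder} point. w extreme_point_of kostka.feasible} = vertex ` labels CARD('n)"
proof (rule kostka.extreme_points_of_compact_feasible)
  show "compact (kostka.feasible :: 'n point set)" by (rule compact_kostka_feasible)
  show "vertex ` labels CARD('n) \<subseteq> (kostka.feasible :: 'n point set)"
    using vertex_feasible by blast
  show "\<exists>v\<in>(vertex ` labels CARD('n) :: 'n point set). kostka.support v \<subseteq> kostka.support w"
    if w: "w \<in> kostka.feasible" for w :: "'n point"
  proof -
    obtain x where x: "x \<in> labels CARD('n)" "label_support x \<subseteq> kostka.support w"
      using ex_label_support_subset[OF w] .
    then show ?thesis by (intro bexI[of _ "vertex x"]) (simp_all add: support_vertex)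
  qed
  show "v = w" if "v \<in> vertex ` labels CARD('n)" "w \<in> vertex ` labels CARD('n)"
    "kostka.support v \<subseteq> kostka.support w" for v w :: "'n point"
    using that by (auto simp: support_vertex dest: label_support_mono_imp_eq)
qed

lemma kostka_polytope_eq_feasible: "kostka_polytope = (kostka.feasible :: 'n::{finite,linorder} point set)"
proof -
  have polytope: "kostka_polytope = kostka_cone \<inter> {w :: 'n point. (\<Sum>i\<in>UNIV. fst w $ i + snd w $ i) = 1}"
    by (auto simp: kostka_polytope_def)
  have "kostka.feasible = convex hull (vertex ` labels CARD('n) :: 'n point set)"
    using Krein_Milman_Minkowski[OF compact_kostka_feasible[where 'n='n] kostka.convex_feasible]
    unfolding extreme_points_of_kostka_feasible .
  also have "\<dots> \<subseteq> kostka_cone"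
    using vertex_in_kostka_cone by (intro hull_minimal) (auto simp: convex_kostka_cone)
  finally have "kostka.feasible \<subseteq> (kostka_cone :: 'n point set)" .
  then show ?thesis
    using kostka_cone_subset_dominance_cone by (auto simp: polytope kostka_feasible_iff_dominance_cone)
qed

lemma vertex_eq_iff:
  assumes "x \<in> labels CARD('n)" "y \<in> labels CARD('n)"
  shows "(vertex x :: 'n::{finite,linorder} point) = vertex y \<longleftrightarrow> x = y"
  using assms support_vertex[of x, where 'n='n] support_vertex[of y, where 'n='n]
    label_support_mono_imp_eq by (metis order_refl)

theorem theorem4p5:
  fixes u v :: "(real ^ 'n::{finite,linorder}) \<times> (real ^ 'n::{finite,linorder})"
    and a b l a' b' l' :: nat
  assumes "u extreme_point_of kostka_polytope"
    and "v extreme_point_of kostka_polytope"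
    and "u \<noteq> v"
    and "labeled u (a, b, l)"
    and "labeled v (a', b', l')"
    and "a - b \<le> a' - b'"
  shows "(\<exists>F. F face_of kostka_polytope \<and> {x. x extreme_point_of F} = {u, v}) \<longleftrightarrow>
    (a = b \<and> (a' = b' \<or> a = b' \<or> a \<ge> a' \<or> l' \<ge> a)) \<or>
    (a \<noteq> b \<and>
      ((a = a' \<and> b = b' \<or> a = a' \<and> l = l' \<or> b = b' \<and> l = l') \<or> l \<ge> a' \<or> l' \<ge> a))"
proof -
  let ?x = "(a, b, l)" and ?y = "(a', b', l')"
  have extreme: "u extreme_point_of kostka.feasible" "v extreme_point_of kostka.feasible"
    using assms(1,2) by (simp_all add: kostka_polytope_eq_feasible)
  then have "u \<in> kostka.feasible" "v \<in> kostka.feasible"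
    by (simp_all add: extreme_point_of_def)
  with assms(4,5) have labels: "?x \<in> labels CARD('n)" "?y \<in> labels CARD('n)"
    and vertices: "u = vertex ?x" "v = vertex ?y"
    by (blast dest: labeled_imp_vertex)+
  have "(\<exists>F. F face_of kostka_polytope \<and> {x. x extreme_point_of F} = {u, v}) \<longleftrightarrow>
      (\<forall>w\<in>{w. w extreme_point_of kostka.feasible}.
        kostka.support w \<subseteq> kostka.support u \<union> kostka.support v \<longrightarrow> w \<in> {u, v})"
    unfolding kostka_polytope_eq_feasible kostka.ex_face_extreme_points_iff[OF extreme] by blast
  also have "\<dots> \<longleftrightarrow> (\<forall>z\<in>labels CARD('n).
        label_support z \<subseteq> label_support ?x \<union> label_support ?y \<longrightarrow> z \<in> {?x, ?y})"
    unfolding extreme_points_of_kostka_feasible using labels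
    by (simp add: vertices support_vertex vertex_eq_iff)
  also have "\<dots> \<longleftrightarrow> adjacent_labels ?x ?y"
    by (rule adjacent_labels_iff_no_third_label[OF labels assms(6), symmetric])
  finally show ?thesis by (simp add: adjacent_labels_def)
qed

end
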